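(* Let $\mathbf{k}$ be a field and let $B$ be the commutative polynomial algebra in $|\mathbb{N}|$ (countably infinitely many) variables over $\mathbf{k}$. Then there exists a Lie subalgebra $L$ of $\mathrm{Der}_{\mathbf{k}}(B)$ satisfying: (a) $\mathrm{Nil}(L)\neq B$, and if $\mathrm{char}\,\mathbf{k}=0$ then $\mathrm{Nil}(L)=\mathbf{k}$; (b) every finitely generated Lie subalgebra $L_0$ of $L$ satisfies $\mathrm{UNil}(L_0)=B$; (c) every finitely generated Lie subalgebra of $L$ is a nilpotent Lie algebra. (In particular, (b) implies that every element of $L$ is a locally nilpotent derivation of $B$.)
   Context: $\mathbb{N}=\{0,1,2,\dots\}$. $\mathrm{Der}_{\mathbf{k}}(B)$ is the Lie algebra over $\mathbf{k}$ of all $\mathbf{k}$-derivations $B\to B$, with bracket $[D,E]=D\circ E-E\circ D$. For a nonempty subset $\Delta$ of $\mathrm{Der}_{\mathbf{k}}(B)$: $\mathrm{Nil}(\Delta)$ is the set of all $x\in B$ such that for every infinite sequence $(F_0,F_1,\dots)$ of elements of $\Delta$ there exists $n\in\mathbb{N}$ with $(F_n\circ\cdots\circ F_0)(x)=0$; $\mathrm{UNil}(\Delta)$ is the set of all $x\in B$ for which there exists $n\in\mathbb{N}$ such that $(F_n\circ\cdots\circ F_1)(x)=0$ for all $(F_1,\dots,F_n)\in\Delta^n$. A derivation $D$ is locally nilpotent if for each $x\in B$ there is $n>0$ with $D^n(x)=0$. A Lie algebra $A$ is nilpotent if there exists $n\ge1$ such that $[x_n,[x_{n-1},\dots,[x_2,x_1]\dots]]=0$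 for all $(x_1,\dots,x_n)\in A^n$. *)

theory Defs
  imports Complex_Main "HOL-Library.Poly_Mapping"
begin

text \<open>
  Monomials are finitely supported exponent vectors; the product of \<^theory>\<open>HOL-Library.Poly_Mapping\<close>
  is the convolution product, so this is the polynomial ring in the variables
  \<open>X\<^sub>0, X\<^sub>1, X\<^sub>2, \<dots>\<close>.
\<close>

type_synonym 'k inf_poly = "(nat \<Rightarrow>\<^sub>0 nat) \<Rightarrow>\<^sub>0 'k"

definition const_poly :: "'k::field \<Rightarrow> 'k inf_poly" where
  "const_poly c = Poly_Mapping.single 0 c"

definition derivations :: "('k::field inf_poly \<Rightarrow> 'k inf_poly) set" where
  "derivations = {D.
     (\<forall>p q. D (p + q) = D p + D q) \<and>
     (\<forall>c p. D (const_poly c * p) = const_poly c * D p) \<and>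
     (\<forall>p q. D (p * q) = D p * q + p * D q)}"

definition lie_bracket :: "('b::ab_group_add \<Rightarrow> 'b) \<Rightarrow> ('b \<Rightarrow> 'b) \<Rightarrow> 'b \<Rightarrow> 'b" where
  "lie_bracket D E = (\<lambda>p. D (E p) - E (D p))"

definition lie_subalgebra :: "('k::field inf_poly \<Rightarrow> 'k inf_poly) set \<Rightarrow> bool" where
  "lie_subalgebra L \<longleftrightarrow>
     L \<subseteq> derivations \<and>
     (\<lambda>p. 0) \<in> L \<and>
     (\<forall>D\<in>L. \<forall>E\<in>L. (\<lambda>p. D p + E p) \<in> L) \<and>
     (\<forall>c. \<forall>D\<in>L. (\<lambda>p. const_poly c * D p) \<in> L) \<and>
     (\<forall>D\<in>L. \<forall>E\<in>L. lie_bracket D E \<in> L)"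

definition fin_gen_lie_subalgebra :: "('k::field inf_poly \<Rightarrow> 'k inf_poly) set \<Rightarrow> bool" where
  "fin_gen_lie_subalgebra L \<longleftrightarrow>
     lie_subalgebra L \<and> (\<exists>S. finite S \<and> S \<subseteq> L \<and> L = lie_subalgebra hull S)"

text \<open>
  \<open>fold lie_bracket [x\<^sub>2, \<dots>, x\<^sub>n] x\<^sub>1 = [x\<^sub>n, [x\<^bsub>n-1\<^esub>, \<dots>, [x\<^sub>2, x\<^sub>1]\<dots>]]\<close>, and a list of
  length \<open>n \<ge> 1\<close> is written as \<open>x\<^sub>1 # xs\<close>.
\<close>

definition nilpotent_lie :: "('b::ab_group_add \<Rightarrow> 'b) set \<Rightarrow> bool" where
  "nilpotent_lie A \<longleftrightarrow>
     (\<exists>n\<ge>1. \<forall>x xs. x \<in> A \<and> set xs \<subseteq> A \<and> length (x # xs) = n \<longrightarrow>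
        fold lie_bracket xs x = (\<lambda>p. 0))"

definition locally_nilpotent :: "('b::zero \<Rightarrow> 'b) \<Rightarrow> bool" where
  "locally_nilpotent D \<longleftrightarrow> (\<forall>p. \<exists>n>0. (D ^^ n) p = 0)"

text \<open>
  \<open>fold (\<lambda>F. F) [F\<^sub>1, \<dots>, F\<^sub>n] x = F\<^sub>n (\<dots> (F\<^sub>1 x))\<close>.
\<close>

definition Nil_set :: "('b::zero \<Rightarrow> 'b) set \<Rightarrow> 'b set" where
  "Nil_set \<Delta> = {x. \<forall>F :: nat \<Rightarrow> 'b \<Rightarrow> 'b. (\<forall>i. F i \<in> \<Delta>) \<longrightarrow>
     (\<exists>n. fold (\<lambda>f. f) (map F [0..<Suc n]) x = 0)}"

definition UNil_set :: "('b::zero \<Rightarrow> 'b) set \<Rightarrow> 'b set" where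
  "UNil_set \<Delta> = {x. \<exists>n. \<forall>Fs. set Fs \<subseteq> \<Delta> \<and> length Fs = n \<longrightarrow> fold (\<lambda>f. f) Fs x = 0}"

end

theory Submission
  imports Defs
begin

text \<open>
  Take for \<open>L\<close> the strictly triangular linear derivations of finite rank: those \<open>D\<close> for which there
  is an \<open>N\<close> such that every \<open>D X\<^sub>i\<close> is a linear combination of the \<open>X\<^sub>j\<close> with \<open>i < j < N\<close>. For a fixed
  \<open>N\<close> they form a Lie algebra \<open>L\<^sub>N\<close> in which every product of \<open>N + 1\<close> elements kills all variables.
  A finitely generated subalgebra of \<open>L\<close> lies in some \<open>L\<^sub>N\<close>; filtering the polynomials by the length
  of the products of derivations that kill them then gives both (b) and (c).
  On the other hand, if \<open>\<partial>f/\<partial>X\<^sub>i \<noteq> 0\<close> and \<open>M\<close> exceeds \<open>i\<close> and all indices occurring in \<open>f\<close>, the sequence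
  \<open>X\<^sub>M \<partial>\<^sub>i, X\<^bsub>M+1\<^esub> \<partial>\<^sub>M, X\<^bsub>M+2\<^esub> \<partial>\<^bsub>M+1\<^esub>, \<dots>\<close> never kills \<open>f\<close>.
\<close>

section \<open>Polynomials in infinitely many variables\<close>

definition var :: "nat \<Rightarrow> 'k::field inf_poly" where
  "var i = Poly_Mapping.single (Poly_Mapping.single i 1) 1"

lemma poly_mapping_single_induct [case_names zero single add]:
  assumes "P 0" and "\<And>k v. P (Poly_Mapping.single k v)" and "\<And>p q. P p \<Longrightarrow> P q \<Longrightarrow> P (p + q)"
  shows "P (p :: 'a \<Rightarrow>\<^sub>0 'b::comm_monoid_add)"
proof (induction p rule: update_induct)
  case const
  show ?case by (rule assms(1))
next
  case (update f a b)
  have "Poly_Mapping.update a b f = Poly_Mapping.single a b + f"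
    using update by (intro poly_mapping_eqI)
      (auto simp: lookup_update lookup_add lookup_single in_keys_iff)
  then show ?case using assms update by metis
qed

lemma const_poly_simps:
  "const_poly 0 = 0" "const_poly 1 = 1" "const_poly (a + b) = const_poly a + const_poly b"
  "const_poly (a * b) = const_poly a * const_poly b" "const_poly (- a) = - const_poly a"
  by (simp_all add: const_poly_def single_add mult_single single_uminus)

text \<open>Each monomial is a product of variables, so constants and variables generate the
  algebra. Statements about derivations thereby reduce to these generators.\<close>

lemma inf_poly_induct [case_names const var add mult]:
  fixes p :: "'k::field inf_poly"
  assumes const: "\<And>c. P (const_poly c)" and var: "\<And>i. P (var i)"
    and add: "\<And>p q. P p \<Longrightarrow> P q \<Longrightarrow> P (p + q)" and mult: "\<And>p q. P p \<Longrightarrow> P q \<Longrightarrow> P (p * q)"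
  shows "P p"
proof (induction p rule: poly_mapping_single_induct)
  case zero
  show ?case using const[of 0] by (simp add: const_poly_simps)
next
  case (single m c)
  have one: "P 1" using const[of 1] by (simp add: const_poly_simps)
  have "P (Poly_Mapping.single (Poly_Mapping.single i e) 1)" for i e
  proof (induction e)
    case 0
    show ?case using one by simp
  next
    case (Suc e)
    have "Poly_Mapping.single (Poly_Mapping.single i (Suc e)) 1
        = var i * Poly_Mapping.single (Poly_Mapping.single i e) (1::'k)"
      by (simp add: var_def mult_single single_add[symmetric])
    then show ?case using mult[OF var Suc] by simp
  qed
  then have "P (Poly_Mapping.single m 1)"
  proof (induction m rule: poly_mapping_single_induct)
    case (add m m')
    then show ?case using mult[of "Poly_Mapping.single m 1" "Poly_Mapping.single m' 1"]
      by (simp add: mult_single)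
  qed (use one in simp_all)
  moreover have "Poly_Mapping.single m c = const_poly c * Poly_Mapping.single m 1"
    by (simp add: const_poly_def mult_single)
  ultimately show ?case using mult const by metis
qed (rule add)


section \<open>Derivations\<close>

lemma derivationsD:
  assumes "D \<in> derivations"
  shows derivation_add: "D (p + q) = D p + D q"
    and derivation_scale: "D (const_poly c * p) = const_poly c * D p"
    and derivation_mult: "D (p * q) = D p * q + p * D q"
  using assms by (auto simp: derivations_def)

lemma derivation_simps:
  assumes "D \<in> derivations"
  shows derivation_zero: "D 0 = 0" and derivation_const: "D (const_poly c) = 0"
    and derivation_uminus: "D (- p) = - D p" and derivation_diff: "D (p - q) = D p - D q"
proof -
  show zero: "D 0 = 0" using derivation_add[OF assms, of 0 0]
    unfolding add_0_left add_cancel_right_right .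
  have "D 1 = 0" using derivation_mult[OF assms, of 1 1]
    unfolding mult_1_left mult_1_right add_cancel_right_right .
  then show "D (const_poly c) = 0" using derivation_scale[OF assms, of c 1] by simp
  have um: "D (- p) = - D p" for p
    using derivation_add[OF assms, of p "- p"] zero by (simp add: eq_neg_iff_add_eq_0 add.commute)
  then show "D (- p) = - D p" .
  show "D (p - q) = D p - D q" using derivation_add[OF assms, of p "- q"] um by simp
qed

lemma derivation_eq_zeroI:
  assumes D: "D \<in> derivations" and "\<And>i. D (var i) = 0"
  shows "D = (\<lambda>p. 0)"
proof
  fix p
  show "D p = 0"
    by (induction p rule: inf_poly_induct)
      (use assms in \<open>auto simp: derivation_const derivation_add derivation_mult\<close>)
qed

text \<open>Linearity over the field comes from the Leibniz rule for a product with a constant,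
  since the constant has derivative 0.\<close>

lemma derivationsI:
  assumes "\<And>p q. D (p + q) = D p + D q" and "\<And>c. D (const_poly c) = 0"
    and "\<And>p q. D (p * q) = D p * q + p * D q"
  shows "D \<in> derivations"
  unfolding derivations_def by (simp add: assms)

text \<open>In the third claim \<open>q\<close> is an arbitrary polynomial: derivations form a
  module over the whole algebra. This yields scalar multiples and the maps
  \<open>var j * pd i p\<close>.\<close>

lemma derivations_closed:
  shows "(\<lambda>p. 0) \<in> derivations"
    and "D \<in> derivations \<Longrightarrow> E \<in> derivations \<Longrightarrow> (\<lambda>p. D p + E p) \<in> derivations"
    and "D \<in> derivations \<Longrightarrow> (\<lambda>p. q * D p) \<in> derivations"
    and "D \<in> derivations \<Longrightarrow> E \<in> derivations \<Longrightarrow> lie_bracket D E \<in> derivations"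
  by (auto intro!: derivationsI simp: lie_bracket_def derivation_zero derivation_const
      derivation_add derivation_mult algebra_simps)

text \<open>The formal partial derivative. \<open>mapp\<close> multiplies each coefficient by its
  exponent of \<open>var i\<close>; \<open>map_key\<close> pulls back along multiplication by
  \<open>var i\<close>, which lowers that exponent and drops the monomials without
  \<open>var i\<close>.\<close>

definition pd :: "nat \<Rightarrow> 'k::field inf_poly \<Rightarrow> 'k inf_poly" where
  "pd i p = Poly_Mapping.map_key (\<lambda>m. m + Poly_Mapping.single i 1)
     (Poly_Mapping.mapp (\<lambda>m c. of_nat (Poly_Mapping.lookup m i) * c) p)"

lemma lookup_pd:
  "Poly_Mapping.lookup (pd i p) m = of_nat (Suc (Poly_Mapping.lookup m i)) * Poly_Mapping.lookup p (m + Poly_Mapping.single i 1)"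
  by (simp add: pd_def map_key.rep_eq inj_def lookup_mapp lookup_add in_keys_iff when_def)

lemma pd_zero [simp]: "pd i 0 = 0"
  by (intro poly_mapping_eqI) (simp add: lookup_pd)

lemma pd_add: "pd i (p + q) = pd i p + pd i q"
  by (intro poly_mapping_eqI) (simp add: lookup_pd lookup_add algebra_simps)

text \<open>If \<open>var i\<close> does not occur in \<open>m\<close>, the truncated subtraction
  leaves \<open>m\<close> unchanged, but the factor \<open>of_nat 0\<close> makes the right side
  0.\<close>

lemma pd_single:
  "pd i (Poly_Mapping.single m c)
     = Poly_Mapping.single (m - Poly_Mapping.single i 1) (of_nat (Poly_Mapping.lookup m i) * c)"
proof (cases "Poly_Mapping.lookup m i")
  case 0
  then have "m \<noteq> n + Poly_Mapping.single i 1" for n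
    by (metis add_is_0 lookup_add lookup_single_eq one_neq_zero)
  then show ?thesis using 0
    by (intro poly_mapping_eqI) (simp add: lookup_pd lookup_single)
next
  case (Suc e)
  have m: "m - Poly_Mapping.single i 1 + Poly_Mapping.single i 1 = m"
    using Suc by (intro poly_mapping_eqI) (auto simp: lookup_add lookup_minus lookup_single when_def)
  show ?thesis
  proof (intro poly_mapping_eqI)
    fix n
    have "m = n + Poly_Mapping.single i 1 \<longleftrightarrow> m - Poly_Mapping.single i 1 = n"
      using m by (metis add_right_cancel)
    moreover have "Poly_Mapping.lookup m i = Suc (Poly_Mapping.lookup n i)"
      if "m = n + Poly_Mapping.single i 1"
      using that by (simp add: lookup_add)
    ultimately show "Poly_Mapping.lookup (pd i (Poly_Mapping.single m c)) n = Poly_Mapping.lookup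
        (Poly_Mapping.single (m - Poly_Mapping.single i 1) (of_nat (Poly_Mapping.lookup m i) * c)) n"
      by (cases "m = n + Poly_Mapping.single i 1") (simp_all add: lookup_pd lookup_single when_def)
  qed
qed

lemma pd_mult_single:
  "pd i (Poly_Mapping.single m a * Poly_Mapping.single n b)
     = pd i (Poly_Mapping.single m a) * Poly_Mapping.single n b
       + Poly_Mapping.single m a * pd i (Poly_Mapping.single n b)"
proof -
  \<comment> \<open>Truncated subtraction need not commute with adding \<open>l\<close> when
    \<open>var i\<close> is absent from \<open>k\<close>; in that case both coefficients are
    0.\<close>
  have shift: "Poly_Mapping.single (k - Poly_Mapping.single i 1 + l) (of_nat (Poly_Mapping.lookup k i) * c)
      = Poly_Mapping.single (k + l - Poly_Mapping.single i 1) (of_nat (Poly_Mapping.lookup k i) * c)" for k l and c :: 'a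
  proof (cases "Poly_Mapping.lookup k i = 0")
    case False
    then have "k - Poly_Mapping.single i 1 + l = k + l - Poly_Mapping.single i 1"
      by (intro poly_mapping_eqI) (auto simp: lookup_add lookup_minus lookup_single when_def)
    then show ?thesis by simp
  qed simp
  show ?thesis
    using shift[of m n "a * b"] shift[of n m "a * b"]
    by (simp add: pd_single mult_single lookup_add single_add[symmetric] algebra_simps)
qed

lemma pd_derivation: "pd i \<in> derivations"
proof -
  \<comment> \<open>Both sides are additive in \<open>p\<close> and in \<open>q\<close>, so single
    terms suffice.\<close>
  have mult: "pd i (p * q) = pd i p * q + p * pd i q" for p q :: "'k::field inf_poly"
  proof (induction p rule: poly_mapping_single_induct)
    case (single m a)
    show ?case
      by (induction q rule: poly_mapping_single_induct)
        (simp_all add: pd_mult_single pd_add algebra_simps)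
  qed (simp_all add: pd_add algebra_simps)
  then show ?thesis
    by (intro derivationsI) (simp_all add: pd_add const_poly_def pd_single)
qed

lemma pd_var: "pd i (var j) = (if i = j then 1 else 0)"
  by (simp add: var_def pd_single lookup_single when_def)

text \<open>Only finitely many variables occur in a polynomial. This supplies the fresh variables
  for the sequence that never kills \<open>f\<close>.\<close>

lemma pd_eventually_zero: "\<exists>M. \<forall>j\<ge>M. pd j p = 0"
proof (induction p rule: inf_poly_induct)
  case (const c)
  show ?case by (simp add: derivation_const[OF pd_derivation])
next
  case (var i)
  show ?case by (intro exI[of _ "Suc i"]) (simp add: pd_var)
next
  case (add p q)
  then obtain M M' where "\<forall>j\<ge>M. pd j p = 0" "\<forall>j\<ge>M'. pd j q = 0" by blast
  then show ?case by (intro exI[of _ "max M M'"]) (simp add: pd_add)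
next
  case (mult p q)
  then obtain M M' where "\<forall>j\<ge>M. pd j p = 0" "\<forall>j\<ge>M'. pd j q = 0" by blast
  then show ?case
    by (intro exI[of _ "max M M'"]) (simp add: derivation_mult[OF pd_derivation])
qed

text \<open>A nonconstant monomial of \<open>p\<close> survives differentiation by one of its
  variables because its exponent is nonzero in the field. In characteristic \<open>q > 0\<close> the
  power \<open>var i ^ q\<close> would be a counterexample.\<close>

lemma pd_nonzero_if_not_const:
  fixes p :: "'k::field inf_poly"
  assumes "CHAR('k) = 0" and "p \<notin> range const_poly"
  shows "\<exists>i. pd i p \<noteq> 0"
proof -
  have "p \<noteq> const_poly (Poly_Mapping.lookup p 0)" using assms(2) by auto
  then obtain m where m: "Poly_Mapping.lookup p m \<noteq> Poly_Mapping.lookup (const_poly (Poly_Mapping.lookup p 0)) m"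
    by (metis poly_mapping_eqI)
  then have "m \<noteq> 0" "Poly_Mapping.lookup p m \<noteq> 0"
    by (auto simp: const_poly_def lookup_single when_def split: if_splits)
  then obtain i where i: "Poly_Mapping.lookup m i \<noteq> 0" by (metis poly_mapping_eqI lookup_zero)
  have "m - Poly_Mapping.single i 1 + Poly_Mapping.single i 1 = m"
    using i by (intro poly_mapping_eqI) (auto simp: lookup_add lookup_minus lookup_single when_def)
  then have "Poly_Mapping.lookup (pd i p) (m - Poly_Mapping.single i 1)
      = of_nat (Suc (Poly_Mapping.lookup (m - Poly_Mapping.single i 1) i)) * Poly_Mapping.lookup p m"
    by (simp only: lookup_pd)
  also have "\<dots> \<noteq> 0"
    using \<open>Poly_Mapping.lookup p m \<noteq> 0\<close> assms(1) by (simp only: mult_eq_0_iff of_nat_eq_0_iff_char_dvd) simp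
  finally show ?thesis by (metis lookup_zero)
qed


section \<open>Elements killed by all products of a given length\<close>

text \<open>The levels of an ascending filtration whose union is \<open>UNil_set\<close>; naming the
  length \<open>n\<close> makes the loss of level under each operation countable.\<close>

definition killed_by :: "('b::zero \<Rightarrow> 'b) set \<Rightarrow> nat \<Rightarrow> 'b set" where
  "killed_by \<Delta> n = {x. \<forall>Fs. set Fs \<subseteq> \<Delta> \<and> length Fs = n \<longrightarrow> fold (\<lambda>f. f) Fs x = 0}"

lemma UNil_set_eq: "UNil_set \<Delta> = (\<Union>n. killed_by \<Delta> n)"
  by (auto simp: UNil_set_def killed_by_def)

lemma killed_by_0 [simp]: "killed_by \<Delta> 0 = {0}"
  by (auto simp: killed_by_def)

text \<open>\<open>fold\<close> applies the head of the list first, so removing the head gives a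
  recursion on \<open>n\<close>. The closure properties of the filtration are inductions along
  it.\<close>

lemma killed_by_Suc: "x \<in> killed_by \<Delta> (Suc n) \<longleftrightarrow> (\<forall>D\<in>\<Delta>. D x \<in> killed_by \<Delta> n)"
proof
  assume *: "x \<in> killed_by \<Delta> (Suc n)"
  show "\<forall>D\<in>\<Delta>. D x \<in> killed_by \<Delta> n"
    unfolding killed_by_def
  proof (intro ballI CollectI allI impI)
    fix D Fs
    assume "D \<in> \<Delta>" "set Fs \<subseteq> \<Delta> \<and> length Fs = n"
    then have "set (D # Fs) \<subseteq> \<Delta> \<and> length (D # Fs) = Suc n" by simp
    then have "fold (\<lambda>f. f) (D # Fs) x = 0" using * unfolding killed_by_def by blast
    then show "fold (\<lambda>f. f) Fs (D x) = 0" by simp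
  qed
next
  assume "\<forall>D\<in>\<Delta>. D x \<in> killed_by \<Delta> n"
  then show "x \<in> killed_by \<Delta> (Suc n)"
    by (auto simp: killed_by_def length_Suc_conv)
qed

lemma killed_by_antimono: "\<Delta> \<subseteq> \<Delta>' \<Longrightarrow> killed_by \<Delta>' n \<subseteq> killed_by \<Delta> n"
  by (auto simp: killed_by_def)

context
  fixes \<Delta> :: "('k::field inf_poly \<Rightarrow> 'k inf_poly) set"
  assumes der: "\<Delta> \<subseteq> derivations"
begin

lemma zero_in_killed_by: "0 \<in> killed_by \<Delta> n"
proof (induction n)
  case (Suc n)
  have "D 0 = 0" if "D \<in> \<Delta>" for D using that der derivation_zero by blast
  with Suc show ?case by (metis killed_by_Suc)
qed simp

lemma killed_by_Suc_mono: "x \<in> killed_by \<Delta> n \<Longrightarrow> x \<in> killed_by \<Delta> (Suc n)"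
proof (induction n arbitrary: x)
  case 0
  then show ?case using zero_in_killed_by by simp
next
  case (Suc n)
  then show ?case by (metis killed_by_Suc)
qed

lemma killed_by_mono: "m \<le> n \<Longrightarrow> killed_by \<Delta> m \<subseteq> killed_by \<Delta> n"
  by (rule lift_Suc_mono_le) (use killed_by_Suc_mono in auto)

lemma killed_by_add:
  "p \<in> killed_by \<Delta> n \<Longrightarrow> q \<in> killed_by \<Delta> n \<Longrightarrow> p + q \<in> killed_by \<Delta> n"
proof (induction n arbitrary: p q)
  case (Suc n)
  have "D (p + q) \<in> killed_by \<Delta> n" if "D \<in> \<Delta>" for D
    using that der Suc by (subst derivation_add) (auto simp: killed_by_Suc)
  then show ?case unfolding killed_by_Suc by blast
qed simp

lemma killed_by_uminus: "p \<in> killed_by \<Delta> n \<Longrightarrow> - p \<in> killed_by \<Delta> n"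
proof (induction n arbitrary: p)
  case (Suc n)
  have "D (- p) \<in> killed_by \<Delta> n" if "D \<in> \<Delta>" for D
    using that der Suc by (subst derivation_uminus) (auto simp: killed_by_Suc)
  then show ?case unfolding killed_by_Suc by blast
qed simp

lemma killed_by_diff:
  "p \<in> killed_by \<Delta> n \<Longrightarrow> q \<in> killed_by \<Delta> n \<Longrightarrow> p - q \<in> killed_by \<Delta> n"
  using killed_by_add[of p n "- q"] killed_by_uminus by simp

text \<open>By the Leibniz rule a derivation gives two products, in each of which one factor has
  dropped a level, so induction on the sum of the levels applies.\<close>

lemma killed_by_mult:
  "p \<in> killed_by \<Delta> m \<Longrightarrow> q \<in> killed_by \<Delta> n \<Longrightarrow> p * q \<in> killed_by \<Delta> (m + n)"
proof (induction "m + n" arbitrary: m n p q)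
  case (Suc k)
  show ?case
  \<comment> \<open>At level 0 a factor cannot drop further, but then it is 0 and so is the
    product.\<close>
  proof (cases "m = 0 \<or> n = 0")
    case True
    then show ?thesis using Suc.prems zero_in_killed_by by auto
  next
    case False
    then obtain m' n' where mn: "m = Suc m'" "n = Suc n'" by (metis not0_implies_Suc)
    have "D (p * q) \<in> killed_by \<Delta> k" if "D \<in> \<Delta>" for D
    proof -
      have "D p * q \<in> killed_by \<Delta> (m' + n)"
        using Suc.hyps(2) Suc.prems mn that by (intro Suc.hyps(1)) (auto simp: killed_by_Suc)
      moreover have "p * D q \<in> killed_by \<Delta> (m + n')"
        using Suc.hyps(2) Suc.prems mn that by (intro Suc.hyps(1)) (auto simp: killed_by_Suc)
      moreover have "m' + n = k" "m + n' = k" using Suc.hyps(2) mn by auto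
      moreover have "D \<in> derivations" using that der by blast
      ultimately show ?thesis by (simp add: derivation_mult killed_by_add)
    qed
    then show ?thesis unfolding Suc.hyps(2)[symmetric] killed_by_Suc by blast
  qed
qed simp

lemma UNil_set_eq_UNIV:
  assumes "\<And>i. var i \<in> killed_by \<Delta> N"
  shows "UNil_set \<Delta> = UNIV"
proof -
  have "\<exists>n. p \<in> killed_by \<Delta> n" for p
  proof (induction p rule: inf_poly_induct)
    case (const c)
    have "D (const_poly c) = 0" if "D \<in> \<Delta>" for D using that der derivation_const by blast
    then have "const_poly c \<in> killed_by \<Delta> (Suc 0)" by (simp add: killed_by_Suc)
    then show ?case by blast
  next
    case (var i)
    show ?case using assms by blast
  next
    case (add p q)
    then obtain m n where "p \<in> killed_by \<Delta> m" "q \<in> killed_by \<Delta> n" by blast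
    then have "p \<in> killed_by \<Delta> (max m n)" "q \<in> killed_by \<Delta> (max m n)"
      using killed_by_mono[of m "max m n"] killed_by_mono[of n "max m n"] by auto
    then show ?case using killed_by_add by blast
  next
    case (mult p q)
    then show ?case using killed_by_mult by blast
  qed
  then show ?thesis by (auto simp: UNil_set_eq)
qed

section \<open>Iterated brackets and nilpotency\<close>

lemma fold_lie_bracket_derivation:
  "x \<in> derivations \<Longrightarrow> set xs \<subseteq> \<Delta> \<Longrightarrow> fold lie_bracket xs x \<in> derivations"
  by (induction xs arbitrary: x) (use der derivations_closed(4) in auto)

text \<open>If \<open>x\<close> lowers levels by \<open>a\<close>, both composites of
  \<open>x\<close> with some \<open>D\<close> in \<open>\<Delta>\<close> lower them by
  \<open>a + 1\<close>, hence so does the bracket. The first premise ranges over all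
  \<open>m\<close> because the two composites use it at different levels.\<close>

lemma fold_lie_bracket_killed_by:
  assumes "\<And>m p. p \<in> killed_by \<Delta> (m + a) \<Longrightarrow> x p \<in> killed_by \<Delta> m"
    and "x \<in> derivations" and "set xs \<subseteq> \<Delta>" and "p \<in> killed_by \<Delta> (m + a + length xs)"
  shows "fold lie_bracket xs x p \<in> killed_by \<Delta> m"
  using assms
proof (induction xs arbitrary: x a)
  case (Cons D xs)
  have "lie_bracket D x p \<in> killed_by \<Delta> m" if "p \<in> killed_by \<Delta> (m + Suc a)" for m p
  proof -
    have "x p \<in> killed_by \<Delta> (Suc m)" using Cons.prems(1)[of p "Suc m"] that by simp
    moreover have "D p \<in> killed_by \<Delta> (m + a)" using that Cons.prems(3) by (simp add: killed_by_Suc)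
    then have "x (D p) \<in> killed_by \<Delta> m" by (rule Cons.prems(1))
    ultimately show ?thesis
      using Cons.prems(3) killed_by_diff by (simp add: lie_bracket_def killed_by_Suc)
  qed
  moreover have "lie_bracket D x \<in> derivations"
    using Cons.prems(2,3) der by (intro derivations_closed(4)) auto
  ultimately show ?case using Cons.IH[of "Suc a" "lie_bracket D x"] Cons.prems by simp
qed simp

lemma nilpotent_lieI:
  assumes "\<And>i. var i \<in> killed_by \<Delta> N"
  shows "nilpotent_lie \<Delta>"
  unfolding nilpotent_lie_def
\<comment> \<open>\<open>Suc N\<close> is at least 1 even for \<open>N = 0\<close>. Then
  \<open>xs\<close> has length \<open>N\<close>, and together with \<open>x\<close> the levels drop
  by \<open>Suc N\<close>.\<close>
proof (intro exI[of _ "Suc N"] conjI allI impI)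
  fix x xs
  assume *: "x \<in> \<Delta> \<and> set xs \<subseteq> \<Delta> \<and> length (x # xs) = Suc N"
  have "fold lie_bracket xs x (var i) = 0" for i
  proof -
    have "var i \<in> killed_by \<Delta> (0 + 1 + length xs)"
      using assms[of i] * by (simp add: killed_by_Suc_mono)
    then have "fold lie_bracket xs x (var i) \<in> killed_by \<Delta> 0"
      using * der by (intro fold_lie_bracket_killed_by[where a = 1]) (auto simp: killed_by_Suc)
    then show ?thesis by simp
  qed
  then show "fold lie_bracket xs x = (\<lambda>p. 0)"
    using * der by (intro derivation_eq_zeroI fold_lie_bracket_derivation) auto
qed simp

end


section \<open>Triangular derivations\<close>

text \<open>The linear span of the variables with index strictly between \<open>i\<close> and
  \<open>N\<close>, built term by term so that its properties follow by rule induction.\<close>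

inductive_set lin_forms :: "nat \<Rightarrow> nat \<Rightarrow> 'k::field inf_poly set" for i N where
  zero: "0 \<in> lin_forms i N"
| step: "p \<in> lin_forms i N \<Longrightarrow> i < j \<Longrightarrow> j < N \<Longrightarrow> const_poly c * var j + p \<in> lin_forms i N"

lemma lin_forms_add: "p \<in> lin_forms i N \<Longrightarrow> q \<in> lin_forms i N \<Longrightarrow> p + q \<in> lin_forms i N"
  by (induction p rule: lin_forms.induct) (auto simp: add.assoc intro: lin_forms.intros)

lemma lin_forms_scale: "p \<in> lin_forms i N \<Longrightarrow> const_poly c * p \<in> lin_forms i N"
proof (induction p rule: lin_forms.induct)
  case (step p j d)
  have "const_poly c * (const_poly d * var j + p)
      = const_poly (c * d) * var j + const_poly c * p"
    by (simp add: const_poly_simps algebra_simps)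
  then show ?case using step by (auto intro: lin_forms.intros)
qed (simp add: lin_forms.zero)

lemma lin_forms_diff: "p \<in> lin_forms i N \<Longrightarrow> q \<in> lin_forms i N \<Longrightarrow> p - q \<in> lin_forms i N"
  using lin_forms_add[of p i N "const_poly (-1) * q"] lin_forms_scale[of q i N "-1"]
  by (simp add: const_poly_simps)

lemma lin_forms_mono:
  "p \<in> lin_forms i N \<Longrightarrow> i' \<le> i \<Longrightarrow> N \<le> N' \<Longrightarrow> p \<in> lin_forms i' N'"
  by (induction p rule: lin_forms.induct) (auto intro: lin_forms.intros)

text \<open>One bound \<open>N\<close> serves every \<open>i\<close>; in particular
  \<open>D (var i) = 0\<close> as soon as \<open>N \<le> Suc i\<close>.\<close>

definition triangular :: "nat \<Rightarrow> ('k::field inf_poly \<Rightarrow> 'k inf_poly) set" where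
  "triangular N = {D \<in> derivations. \<forall>i. D (var i) \<in> lin_forms i N}"

lemma triangular_derivations: "triangular N \<subseteq> derivations"
  by (auto simp: triangular_def)

lemma triangular_mono: "N \<le> N' \<Longrightarrow> triangular N \<subseteq> triangular N'"
  by (auto simp: triangular_def intro: lin_forms_mono)

text \<open>A variable of index \<open>j > i\<close> goes to variables of index above
  \<open>j\<close>, hence above \<open>Suc i\<close>.\<close>

lemma triangular_lin_forms:
  assumes D: "D \<in> triangular N" and "p \<in> lin_forms i N"
  shows "D p \<in> lin_forms (Suc i) N"
  using assms(2)
proof (induction p rule: lin_forms.induct)
  case zero
  show ?case using D triangular_derivations derivation_zero lin_forms.zero by (metis subsetD)
next
  case (step p j c)
  have "D (var j) \<in> lin_forms j N" using D by (simp add: triangular_def)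
  then have "D (var j) \<in> lin_forms (Suc i) N" using step by (auto intro: lin_forms_mono)
  moreover have "D (const_poly c * var j + p) = const_poly c * D (var j) + D p"
    using D by (simp add: triangular_def derivation_add derivation_scale)
  ultimately show ?case using step lin_forms_add lin_forms_scale by metis
qed

lemma lie_subalgebra_triangular: "lie_subalgebra (triangular N)"
proof -
  have "lie_bracket D E (var i) \<in> lin_forms i N"
    if "D \<in> triangular N" "E \<in> triangular N" for D E :: "'a inf_poly \<Rightarrow> _" and i
  proof -
    have "D (E (var i)) \<in> lin_forms (Suc i) N" "E (D (var i)) \<in> lin_forms (Suc i) N"
      using that by (intro triangular_lin_forms; simp add: triangular_def)+
    then show ?thesis
      unfolding lie_bracket_def by (intro lin_forms_diff) (auto intro: lin_forms_mono)
  qed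
  then have "lie_bracket D E \<in> triangular N"
    if "D \<in> triangular N" "E \<in> triangular N" for D E :: "'a inf_poly \<Rightarrow> _"
    using that triangular_derivations derivations_closed(4) by (auto simp: triangular_def)
  then show ?thesis
    unfolding lie_subalgebra_def
    by (auto simp: triangular_def derivations_closed lin_forms.zero intro: lin_forms_add lin_forms_scale)
qed

text \<open>Each application raises the lower index bound by one, and after \<open>N - i\<close>
  applications no index is left below \<open>N\<close>.\<close>

lemma lin_forms_killed_by: "p \<in> lin_forms i N \<Longrightarrow> p \<in> killed_by (triangular N) (N - i)"
proof (induction "N - i" arbitrary: i p)
  case 0
  from 0(2) have "p = 0" using 0(1) by cases auto
  then show ?case by (simp add: zero_in_killed_by triangular_derivations)
next
  case (Suc n)
  have "D p \<in> killed_by (triangular N) n" if "D \<in> triangular N" for D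
  proof -
    have n: "n = N - Suc i" using Suc.hyps(2) by simp
    show ?thesis
      using Suc.hyps(1)[OF n triangular_lin_forms[OF that Suc.prems]] n by simp
  qed
  then show ?case using Suc.hyps(2)[symmetric] by (simp add: killed_by_Suc)
qed

text \<open>The first application lands in \<open>lin_forms i N\<close>, and at most
  \<open>N\<close> more give 0. The resulting bound is independent of \<open>i\<close>, also for
  \<open>i \<ge> N\<close>.\<close>

lemma var_killed_by_triangular: "var i \<in> killed_by (triangular N) (Suc N)"
proof -
  have "D (var i) \<in> killed_by (triangular N) N" if "D \<in> triangular N" for D
  proof -
    have "D (var i) \<in> killed_by (triangular N) (N - i)"
      using that by (intro lin_forms_killed_by) (simp add: triangular_def)
    then show ?thesis using killed_by_mono[OF triangular_derivations, of "N - i" N] by auto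
  qed
  then show ?thesis unfolding killed_by_Suc by blast
qed

lemma elementary_triangular:
  assumes "i < j" "j < N"
  shows "(\<lambda>p. var j * pd i p) \<in> triangular N"
proof -
  have "var j \<in> lin_forms i N"
    using lin_forms.step[OF lin_forms.zero assms, of 1] by (simp add: const_poly_simps)
  then show ?thesis
    by (simp add: triangular_def derivations_closed(3) pd_derivation pd_var lin_forms.zero)
qed

section \<open>The union over all bounds and its finitely generated subalgebras\<close>

lemma finite_subset_triangular:
  assumes "finite S" and "S \<subseteq> (\<Union>N. triangular N)"
  shows "\<exists>N. S \<subseteq> triangular N"
  using assms
proof (induction S rule: finite_induct)
  case (insert D S)
  then obtain M N where "S \<subseteq> triangular M" "D \<in> triangular N" by auto
  then have "insert D S \<subseteq> triangular (max M N)"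
    using triangular_mono[of M "max M N"] triangular_mono[of N "max M N"] by auto
  then show ?case by blast
qed simp

text \<open>The union is directed: two elements already lie in a common \<open>triangular N\<close>,
  where the operations can be carried out.\<close>

lemma lie_subalgebra_triangular_Union: "lie_subalgebra (\<Union>N. triangular N)"
proof -
  have two: "\<exists>N. D \<in> triangular N \<and> E \<in> triangular N"
    if "D \<in> triangular M" "E \<in> triangular M'" for D E :: "'a inf_poly \<Rightarrow> _" and M M'
    using finite_subset_triangular[of "{D, E}"] that by auto
  show ?thesis
    unfolding lie_subalgebra_def
  proof (intro conjI ballI allI)
    fix D E :: "'a inf_poly \<Rightarrow> _"
    assume "D \<in> (\<Union>N. triangular N)" "E \<in> (\<Union>N. triangular N)"
    then obtain N where "D \<in> triangular N" "E \<in> triangular N" using two by blast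
    then show "(\<lambda>p. D p + E p) \<in> (\<Union>N. triangular N)" "lie_bracket D E \<in> (\<Union>N. triangular N)"
      using lie_subalgebra_triangular[of N] unfolding lie_subalgebra_def by blast+
  next
    fix c and D :: "'a inf_poly \<Rightarrow> _"
    assume "D \<in> (\<Union>N. triangular N)"
    then show "(\<lambda>p. const_poly c * D p) \<in> (\<Union>N. triangular N)"
      using lie_subalgebra_triangular unfolding lie_subalgebra_def by blast
  qed (use lie_subalgebra_triangular in \<open>unfold lie_subalgebra_def, blast\<close>)+
qed

text \<open>Finitely many generators share one bound \<open>N\<close>, and
  \<open>triangular N\<close>, being a Lie subalgebra, contains the hull they generate.\<close>

lemma fin_gen_subset_triangular:
  assumes "fin_gen_lie_subalgebra L0" and "L0 \<subseteq> (\<Union>N. triangular N)"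
  shows "\<exists>N. L0 \<subseteq> triangular N"
proof -
  obtain S where S: "finite S" "S \<subseteq> L0" "L0 = lie_subalgebra hull S"
    using assms(1) unfolding fin_gen_lie_subalgebra_def by blast
  then obtain N where "S \<subseteq> triangular N"
    using finite_subset_triangular[of S] assms(2) by blast
  then have "L0 \<subseteq> triangular N"
    using S(3) hull_minimal lie_subalgebra_triangular by blast
  then show ?thesis by blast
qed

text \<open>The invariant is that the first \<open>n + 1\<close> maps send \<open>f\<close> to
  \<open>var (M + n) * pd i f\<close>. The next map differentiates the fresh variable away and
  multiplies by a new one.\<close>

lemma pd_nonzero_not_Nil:
  fixes f :: "'k::field inf_poly"
  assumes "pd i f \<noteq> 0"
  shows "f \<notin> Nil_set (\<Union>N. triangular N)"
proof
  assume *: "f \<in> Nil_set (\<Union>N. triangular N)"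
  obtain M0 where M0: "\<forall>j\<ge>M0. pd j (pd i f) = 0" using pd_eventually_zero by blast
  \<comment> \<open>\<open>M \<ge> M0\<close> makes the later partial derivatives vanish on
    \<open>pd i f\<close>; \<open>M > i\<close> makes \<open>F 0\<close> triangular.\<close>
  define M where "M = max M0 (Suc i)"
  define F :: "nat \<Rightarrow> 'k inf_poly \<Rightarrow> 'k inf_poly" where "F = (\<lambda>n p. var (M + n) * pd (if n = 0 then i else M + n - 1) p)"
  have "F n \<in> triangular (Suc (M + n))" for n
    unfolding F_def by (rule elementary_triangular) (auto simp: M_def)
  then have "\<forall>n. F n \<in> (\<Union>N. triangular N)" by blast
  then obtain n where n: "fold (\<lambda>f. f) (map F [0..<Suc n]) f = 0"
    using * unfolding Nil_set_def by blast
  have pdM: "pd (M + n) (pd i f) = 0" for n using M0 by (simp add: M_def)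
  have shift: "pd (M + n) (var (M + n) * pd i f) = pd i f" for n
    by (simp add: derivation_mult[OF pd_derivation] pd_var pdM)
  have "fold (\<lambda>f. f) (map F [0..<Suc n]) f = var (M + n) * pd i f" for n
  proof (induction n)
    case 0
    show ?case by (simp add: F_def)
  next
    case (Suc n)
    have "fold (\<lambda>f. f) (map F [0..<Suc (Suc n)]) f
        = F (Suc n) (fold (\<lambda>f. f) (map F [0..<Suc n]) f)"
      by (subst upt_Suc) (simp del: upt_Suc)
    then show ?case using Suc shift[of n] by (simp add: F_def del: upt_Suc)
  qed
  then have "var (M + n) * pd i f = 0" using n by metis
  \<comment> \<open>Applying \<open>pd (M + n)\<close> to the vanishing product gives back
    \<open>pd i f\<close>, which is nonzero.\<close>
  then show False using shift[of n] assms derivation_zero[OF pd_derivation] by metis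
qed

lemma const_in_Nil_set:
  assumes "\<Delta> \<subseteq> derivations"
  shows "const_poly c \<in> Nil_set \<Delta>"
  unfolding Nil_set_def
\<comment> \<open>The witness 0 stands for the one-element product \<open>F 0\<close>, which already
  kills constants.\<close>
proof (intro CollectI allI impI exI[of _ 0])
  fix F :: "nat \<Rightarrow> 'a inf_poly \<Rightarrow> 'a inf_poly"
  assume "\<forall>i. F i \<in> \<Delta>"
  then have "F 0 \<in> derivations" using assms by blast
  then show "fold (\<lambda>f. f) (map F [0..<Suc 0]) (const_poly c) = 0"
    by (simp add: derivation_const)
qed

lemma locally_nilpotent_if_UNil:
  assumes "D \<in> \<Delta>" "\<Delta> \<subseteq> derivations" and "UNil_set \<Delta> = UNIV"
  shows "locally_nilpotent D"
  unfolding locally_nilpotent_def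
proof
  fix p
  obtain n where "p \<in> killed_by \<Delta> n" using assms(3) by (auto simp: UNil_set_eq)
  \<comment> \<open>Local nilpotency asks for a positive exponent, so the possibly zero
    \<open>n\<close> is raised by one.\<close>
  then have "p \<in> killed_by \<Delta> (Suc n)" using killed_by_Suc_mono assms(2) by blast
  then have "fold (\<lambda>f. f) (replicate (Suc n) D) p = 0"
    using assms(1) unfolding killed_by_def by (metis (mono_tags, lifting) CollectD
      in_set_replicate length_replicate subsetI)
  moreover have "fold (\<lambda>f. f) (replicate k D) p = (D ^^ k) p" for k
    by (induction k arbitrary: p) (simp_all add: funpow_swap1)
  ultimately show "\<exists>n>0. (D ^^ n) p = 0" by (metis zero_less_Suc)
qed

theorem mainTheorem1:
  shows "\<exists>L :: ('k::field inf_poly \<Rightarrow> 'k inf_poly) set.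
    lie_subalgebra L \<and>
    Nil_set L \<noteq> UNIV \<and>
    (CHAR('k) = 0 \<longrightarrow> Nil_set L = range const_poly) \<and>
    (\<forall>L0. fin_gen_lie_subalgebra L0 \<and> L0 \<subseteq> L \<longrightarrow> UNil_set L0 = UNIV) \<and>
    (\<forall>L0. fin_gen_lie_subalgebra L0 \<and> L0 \<subseteq> L \<longrightarrow> nilpotent_lie L0) \<and>
    (\<forall>D\<in>L. locally_nilpotent D)"
proof -
  let ?L = "\<Union>N. triangular N :: ('k inf_poly \<Rightarrow> 'k inf_poly) set"
  \<comment> \<open>Stated for any subset of \<open>triangular N\<close>, so that it covers the
    finitely generated subalgebras and also \<open>triangular N\<close> itself, which gives local
    nilpotency.\<close>
  have bounded: "UNil_set L0 = UNIV \<and> nilpotent_lie L0"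
    if "L0 \<subseteq> triangular N" for L0 :: "('k inf_poly \<Rightarrow> 'k inf_poly) set" and N
  proof -
    have der: "L0 \<subseteq> derivations" using that triangular_derivations by blast
    have "var i \<in> killed_by L0 (Suc N)" for i
      using killed_by_antimono[OF that] var_killed_by_triangular by blast
    then show ?thesis using UNil_set_eq_UNIV[OF der] nilpotent_lieI[OF der] by blast
  qed
  show ?thesis
  proof (intro exI[of _ ?L] conjI allI impI ballI)
    show "lie_subalgebra ?L" by (rule lie_subalgebra_triangular_Union)
    \<comment> \<open>\<open>pd 0 (var 0) = 1\<close> is nonzero in every characteristic.\<close>
    have "var 0 \<notin> Nil_set ?L" by (rule pd_nonzero_not_Nil[of 0]) (simp add: pd_var)
    then show "Nil_set ?L \<noteq> UNIV" by blast
    show "Nil_set ?L = range const_poly" if "CHAR('k) = 0"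
    proof
      show "Nil_set ?L \<subseteq> range const_poly"
        using pd_nonzero_if_not_const[OF that] pd_nonzero_not_Nil by blast
      show "range const_poly \<subseteq> Nil_set ?L"
        using const_in_Nil_set[of ?L] triangular_derivations by blast
    qed
    show "UNil_set L0 = UNIV" "nilpotent_lie L0"
      if "fin_gen_lie_subalgebra L0 \<and> L0 \<subseteq> ?L" for L0
      using that fin_gen_subset_triangular bounded by blast+
    show "locally_nilpotent D" if D: "D \<in> ?L" for D
    proof -
      obtain N where "D \<in> triangular N" using D by blast
      then show ?thesis
        using locally_nilpotent_if_UNil[of D "triangular N"] triangular_derivations bounded by blast
    qed
  qed
qed

end
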